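(* Let $(\mathcal{C},T,C,\succeq)$ be a target–context category and $s\colon P\otimes C\to T\otimes C$ a simulator. Assume that every functional $r\colon T\to P$ with $s\circ(r\otimes\mathrm{id}_C)\succeq\mathrm{id}_{T\otimes C}$ also satisfies $\mathrm{id}_{T\otimes C}\succeq s\circ(r\otimes\mathrm{id}_C)$. If $s$ is compressed, then there is no simulator morphism from $s$ to the trivial simulator $\mathrm{id}_{T\otimes C}$.
   Context: A gs-monoidal category is a symmetric monoidal category $\mathcal{C}$ (tensor $\otimes$, unit $I$, unitors suppressed) in which every object $A$ carries $\mathrm{copy}_A\colon A\to A\otimes A$, $\mathrm{del}_A\colon A\to I$ forming a commutative comonoid, compatible with $\otimes$, with $\mathrm{del}_I=\mathrm{id}_I$. For $f\colon A\to X$: $\mathrm{dom}(f):=(\mathrm{id}_A\otimes(\mathrm{del}_X\circ f))\circ\mathrm{copy}_A$; $f$ is normalized if $f\circ\mathrm{dom}(f)=f$; functional if $\mathrm{copy}_X\circ f=(f\otimes f)\circ\mathrm{copy}_A$. $f\sqsupseteq g$ means $f\circ\mathrm{dom}(g)=g$. A target–context category $(\mathcal{C},T,C,\succeq)$: a gs-monoidal category with all morphisms normalized, objects $T,C$, and a preorder $\succeq$ on each $\mathcal{C}(A,T\otimes C)$ with $f\sqsupseteq g\Rightarrow f\succeq g$ and $f\succeq g\Rightarrow f\circ h\succeq g\circ h$. A simulator with programs $P$ is $s\colon P\otimes C\to T\otimes C$ such that there are a functional $s_T\colon P\to T$ (compiler) and $s_C\colon P\otimes C\to C$ with $s=(s_T\otimes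 s_C)\circ(\mathrm{copy}_P\otimes\mathrm{id}_C)$, $(\mathrm{id}_T\otimes\mathrm{del}_C)\circ s=s_T\otimes\mathrm{del}_C$, $(\mathrm{del}_T\otimes\mathrm{id}_C)\circ s=s_C$. It is universal if some functional $r\colon T\to P$ (a lax reduction to the trivial simulator) satisfies $s\circ(r\otimes\mathrm{id}_C)\succeq\mathrm{id}_{T\otimes C}$. The trivial simulator is $\mathrm{id}_{T\otimes C}$ with programs $T$. A universal simulator $s$ is compressed if for every such lax reduction $r$ there are functional states $t,g\colon I\to T$ with (i) $s_T\circ r\circ t=s_T\circ r\circ g$, and (ii) there is no morphism $v\colon C\to C$ with $g\otimes\mathrm{id}_C\succeq t\otimes v$. For simulators $s$ (programs $P$) and $s'$ (programs $P'$), a simulator morphism $s\to s'$ is a pair $(r,q)$ of a functional $r\colon P'\to P$ and $q\colon P'\otimes T\otimes C\to T\otimes C$ such that: (i) $q$ is a simulator with programs $P'\otimes T$; (ii) $\mathrm{del}_{P'}\otimes\mathrm{id}_{T\otimes C}\succeq q$; (iii) $s'=q\circ(\mathrm{id}_{P'}\otimes(s\circ(r\otimes\mathrm{id}_C)))\circ(\mathrm{copy}_{P'}\otimes\mathrm{id}_C)$. *)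

theory Defs
  imports Main
begin

text \<open>
  A category is given by a set of objects and a set of arrows with source and target.
  Composition and the tensor of arrows are total functions that are only constrained on
  composable arguments and on arrows, respectively. The monoidal structure is not assumed to be
  strict: where the mathematics suppresses associators and unitors, they are inserted explicitly.
\<close>

record ('o, 'm) gs_cat =
  Obj :: "'o set"
  Arr :: "'m set"
  src :: "'m \<Rightarrow> 'o"
  tgt :: "'m \<Rightarrow> 'o"
  ident :: "'o \<Rightarrow> 'm"  ("\<i>\<d>\<index> _" [90] 90)
  comp :: "'m \<Rightarrow> 'm \<Rightarrow> 'm"  (infixr "\<cdot>\<index>" 55)
  tensor_obj :: "'o \<Rightarrow> 'o \<Rightarrow> 'o"  (infixr "\<odot>\<index>" 70)
  tensor :: "'m \<Rightarrow> 'm \<Rightarrow> 'm"  (infixr "\<otimes>\<index>" 70)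
  unit_obj :: "'o"  ("\<I>\<index>")
  associator :: "'o \<Rightarrow> 'o \<Rightarrow> 'o \<Rightarrow> 'm"  ("\<alpha>\<index>")
  lunitor :: "'o \<Rightarrow> 'm"  ("\<ll>\<index>")
  runitor :: "'o \<Rightarrow> 'm"  ("\<rr>\<index>")
  braiding :: "'o \<Rightarrow> 'o \<Rightarrow> 'm"  ("\<sigma>\<index>")
  copy_arr :: "'o \<Rightarrow> 'm"  ("copy\<index>")
  del_arr :: "'o \<Rightarrow> 'm"  ("del\<index>")

definition hom_set :: "('o, 'm, 'e) gs_cat_scheme \<Rightarrow> 'o \<Rightarrow> 'o \<Rightarrow> 'm set"  ("hom\<index>")
  where "hom_set K A B = {f \<in> Arr K. src K f = A \<and> tgt K f = B}"

definition inverse_arrs :: "('o, 'm, 'e) gs_cat_scheme \<Rightarrow> 'm \<Rightarrow> 'm \<Rightarrow> bool"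
  where "inverse_arrs K f g \<longleftrightarrow>
    f \<in> Arr K \<and> g \<in> hom_set K (tgt K f) (src K f) \<and>
    comp K g f = ident K (src K f) \<and> comp K f g = ident K (tgt K f)"

definition is_iso :: "('o, 'm, 'e) gs_cat_scheme \<Rightarrow> 'm \<Rightarrow> bool"
  where "is_iso K f \<longleftrightarrow> (\<exists>g. inverse_arrs K f g)"

definition inv_arr :: "('o, 'm, 'e) gs_cat_scheme \<Rightarrow> 'm \<Rightarrow> 'm"  ("inv\<index> _" [90] 90)
  where "inv_arr K f = (THE g. inverse_arrs K f g)"

locale gs_category =
  fixes K :: "('o, 'm, 'e) gs_cat_scheme" (structure)
  assumes src_obj: "f \<in> Arr K \<Longrightarrow> src K f \<in> Obj K"
    and tgt_obj: "f \<in> Arr K \<Longrightarrow> tgt K f \<in> Obj K"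
    and ident_hom: "A \<in> Obj K \<Longrightarrow> \<i>\<d> A \<in> hom A A"
    and comp_hom: "\<lbrakk>f \<in> hom A B; g \<in> hom B D\<rbrakk> \<Longrightarrow> g \<cdot> f \<in> hom A D"
    and comp_ident_left: "f \<in> hom A B \<Longrightarrow> \<i>\<d> B \<cdot> f = f"
    and comp_ident_right: "f \<in> hom A B \<Longrightarrow> f \<cdot> \<i>\<d> A = f"
    and comp_assoc: "\<lbrakk>f \<in> hom A B; g \<in> hom B D; h \<in> hom D E\<rbrakk>
      \<Longrightarrow> (h \<cdot> g) \<cdot> f = h \<cdot> (g \<cdot> f)"

locale symmetric_monoidal_category = gs_category +
  assumes unit_obj: "\<I> \<in> Obj K"
    and tensor_obj: "\<lbrakk>A \<in> Obj K; B \<in> Obj K\<rbrakk> \<Longrightarrow> A \<odot> B \<in> Obj K"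
    and tensor_hom: "\<lbrakk>f \<in> hom A B; g \<in> hom A' B'\<rbrakk> \<Longrightarrow> f \<otimes> g \<in> hom (A \<odot> A') (B \<odot> B')"
    and tensor_ident: "\<lbrakk>A \<in> Obj K; B \<in> Obj K\<rbrakk> \<Longrightarrow> \<i>\<d> A \<otimes> \<i>\<d> B = \<i>\<d> (A \<odot> B)"
    and interchange: "\<lbrakk>f \<in> hom A B; g \<in> hom B D; f' \<in> hom A' B'; g' \<in> hom B' D'\<rbrakk>
      \<Longrightarrow> (g \<cdot> f) \<otimes> (g' \<cdot> f') = (g \<otimes> g') \<cdot> (f \<otimes> f')"
    and associator_hom: "\<lbrakk>A \<in> Obj K; B \<in> Obj K; D \<in> Obj K\<rbrakk>
      \<Longrightarrow> \<alpha> A B D \<in> hom ((A \<odot> B) \<odot> D) (A \<odot> (B \<odot> D))"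
    and associator_iso: "\<lbrakk>A \<in> Obj K; B \<in> Obj K; D \<in> Obj K\<rbrakk> \<Longrightarrow> is_iso K (\<alpha> A B D)"
    and associator_natural: "\<lbrakk>f \<in> hom A A'; g \<in> hom B B'; h \<in> hom D D'\<rbrakk>
      \<Longrightarrow> \<alpha> A' B' D' \<cdot> ((f \<otimes> g) \<otimes> h) = (f \<otimes> (g \<otimes> h)) \<cdot> \<alpha> A B D"
    and lunitor_hom: "A \<in> Obj K \<Longrightarrow> \<ll> A \<in> hom (\<I> \<odot> A) A"
    and lunitor_iso: "A \<in> Obj K \<Longrightarrow> is_iso K (\<ll> A)"
    and lunitor_natural: "f \<in> hom A B \<Longrightarrow> \<ll> B \<cdot> (\<i>\<d> \<I> \<otimes> f) = f \<cdot> \<ll> A"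
    and runitor_hom: "A \<in> Obj K \<Longrightarrow> \<rr> A \<in> hom (A \<odot> \<I>) A"
    and runitor_iso: "A \<in> Obj K \<Longrightarrow> is_iso K (\<rr> A)"
    and runitor_natural: "f \<in> hom A B \<Longrightarrow> \<rr> B \<cdot> (f \<otimes> \<i>\<d> \<I>) = f \<cdot> \<rr> A"
    and triangle: "\<lbrakk>A \<in> Obj K; B \<in> Obj K\<rbrakk>
      \<Longrightarrow> (\<i>\<d> A \<otimes> \<ll> B) \<cdot> \<alpha> A \<I> B = \<rr> A \<otimes> \<i>\<d> B"
    and pentagon: "\<lbrakk>A \<in> Obj K; B \<in> Obj K; D \<in> Obj K; E \<in> Obj K\<rbrakk>
      \<Longrightarrow> (\<i>\<d> A \<otimes> \<alpha> B D E) \<cdot> \<alpha> A (B \<odot> D) E \<cdot> (\<alpha> A B D \<otimes> \<i>\<d> E)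
          = \<alpha> A B (D \<odot> E) \<cdot> \<alpha> (A \<odot> B) D E"
    and braiding_hom: "\<lbrakk>A \<in> Obj K; B \<in> Obj K\<rbrakk> \<Longrightarrow> \<sigma> A B \<in> hom (A \<odot> B) (B \<odot> A)"
    and braiding_natural: "\<lbrakk>f \<in> hom A A'; g \<in> hom B B'\<rbrakk>
      \<Longrightarrow> \<sigma> A' B' \<cdot> (f \<otimes> g) = (g \<otimes> f) \<cdot> \<sigma> A B"
    and braiding_symmetric: "\<lbrakk>A \<in> Obj K; B \<in> Obj K\<rbrakk> \<Longrightarrow> \<sigma> B A \<cdot> \<sigma> A B = \<i>\<d> (A \<odot> B)"
    and hexagon: "\<lbrakk>A \<in> Obj K; B \<in> Obj K; D \<in> Obj K\<rbrakk>
      \<Longrightarrow> \<alpha> B D A \<cdot> \<sigma> A (B \<odot> D) \<cdot> \<alpha> A B D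
          = (\<i>\<d> B \<otimes> \<sigma> A D) \<cdot> \<alpha> B A D \<cdot> (\<sigma> A B \<otimes> \<i>\<d> D)"

text \<open>The canonical arrow \<open>(A \<odot> A) \<odot> (B \<odot> B) \<rightarrow> (A \<odot> B) \<odot> (A \<odot> B)\<close>.\<close>

definition middle_swap :: "('o, 'm, 'e) gs_cat_scheme \<Rightarrow> 'o \<Rightarrow> 'o \<Rightarrow> 'm"
  where "middle_swap K A B =
    comp K (inv_arr K (associator K A B (tensor_obj K A B)))
      (comp K (tensor K (ident K A)
          (comp K (associator K B A B)
            (comp K (tensor K (braiding K A B) (ident K B))
              (inv_arr K (associator K A B B)))))
        (associator K A A (tensor_obj K B B)))"

locale gs_monoidal_category = symmetric_monoidal_category +
  assumes copy_hom: "A \<in> Obj K \<Longrightarrow> copy A \<in> hom A (A \<odot> A)"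
    and del_hom: "A \<in> Obj K \<Longrightarrow> del A \<in> hom A \<I>"
    and copy_coassoc: "A \<in> Obj K
      \<Longrightarrow> \<alpha> A A A \<cdot> (copy A \<otimes> \<i>\<d> A) \<cdot> copy A = (\<i>\<d> A \<otimes> copy A) \<cdot> copy A"
    and copy_counit_left: "A \<in> Obj K \<Longrightarrow> \<ll> A \<cdot> (del A \<otimes> \<i>\<d> A) \<cdot> copy A = \<i>\<d> A"
    and copy_counit_right: "A \<in> Obj K \<Longrightarrow> \<rr> A \<cdot> (\<i>\<d> A \<otimes> del A) \<cdot> copy A = \<i>\<d> A"
    and copy_commutative: "A \<in> Obj K \<Longrightarrow> \<sigma> A A \<cdot> copy A = copy A"
    and copy_tensor: "\<lbrakk>A \<in> Obj K; B \<in> Obj K\<rbrakk>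
      \<Longrightarrow> copy (A \<odot> B) = middle_swap K A B \<cdot> (copy A \<otimes> copy B)"
    and del_tensor: "\<lbrakk>A \<in> Obj K; B \<in> Obj K\<rbrakk> \<Longrightarrow> del (A \<odot> B) = \<ll> \<I> \<cdot> (del A \<otimes> del B)"
    and del_unit: "del \<I> = \<i>\<d> \<I>"

definition dom_arr :: "('o, 'm, 'e) gs_cat_scheme \<Rightarrow> 'm \<Rightarrow> 'm"
  where "dom_arr K f =
    comp K (runitor K (src K f))
      (comp K (tensor K (ident K (src K f)) (comp K (del_arr K (tgt K f)) f))
        (copy_arr K (src K f)))"

definition normalized :: "('o, 'm, 'e) gs_cat_scheme \<Rightarrow> 'm \<Rightarrow> bool"
  where "normalized K f \<longleftrightarrow> comp K f (dom_arr K f) = f"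

definition functional :: "('o, 'm, 'e) gs_cat_scheme \<Rightarrow> 'm \<Rightarrow> bool"
  where "functional K f \<longleftrightarrow>
    comp K (copy_arr K (tgt K f)) f = comp K (tensor K f f) (copy_arr K (src K f))"

definition extends :: "('o, 'm, 'e) gs_cat_scheme \<Rightarrow> 'm \<Rightarrow> 'm \<Rightarrow> bool"  (infix "\<sqsupseteq>\<index>" 50)
  where "extends K f g \<longleftrightarrow> comp K f (dom_arr K g) = g"

record ('o, 'm) tc_cat = "('o, 'm) gs_cat" +
  Target :: "'o"  ("\<T>\<index>")
  Context :: "'o"  ("\<C>\<index>")
  geq :: "'m \<Rightarrow> 'm \<Rightarrow> bool"  (infix "\<succeq>\<index>" 50)

text \<open>
  The relation \<open>\<succeq>\<close> only matters, and is only constrained, between parallel arrows into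
  \<open>\<T> \<odot> \<C>\<close>.
\<close>

locale target_context_category = gs_monoidal_category K
  for K :: "('o, 'm, 'e) tc_cat_scheme" (structure) +
  assumes all_normalized: "f \<in> Arr K \<Longrightarrow> normalized K f"
    and target_obj: "\<T> \<in> Obj K"
    and context_obj: "\<C> \<in> Obj K"
    and geq_refl: "f \<in> hom A (\<T> \<odot> \<C>) \<Longrightarrow> f \<succeq> f"
    and geq_trans: "\<lbrakk>f \<in> hom A (\<T> \<odot> \<C>); g \<in> hom A (\<T> \<odot> \<C>); h \<in> hom A (\<T> \<odot> \<C>); f \<succeq> g; g \<succeq> h\<rbrakk>
      \<Longrightarrow> f \<succeq> h"
    and geq_extends: "\<lbrakk>f \<in> hom A (\<T> \<odot> \<C>); g \<in> hom A (\<T> \<odot> \<C>); f \<sqsupseteq> g\<rbrakk> \<Longrightarrow> f \<succeq> g"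
    and geq_precomp: "\<lbrakk>f \<in> hom A (\<T> \<odot> \<C>); g \<in> hom A (\<T> \<odot> \<C>); h \<in> hom B A; f \<succeq> g\<rbrakk>
      \<Longrightarrow> f \<cdot> h \<succeq> g \<cdot> h"

context
  fixes K :: "('o, 'm, 'e) tc_cat_scheme" (structure)
begin

text \<open>
  \<open>simulator_via P s s\<^sub>T s\<^sub>C\<close>: the arrow \<open>s\<close> is a simulator with programs \<open>P\<close>, as witnessed by the
  compiler \<open>s\<^sub>T\<close> and the context part \<open>s\<^sub>C\<close>.
\<close>

definition simulator_via :: "'o \<Rightarrow> 'm \<Rightarrow> 'm \<Rightarrow> 'm \<Rightarrow> bool"
  where "simulator_via P s s\<^sub>T s\<^sub>C \<longleftrightarrow>
    s \<in> hom (P \<odot> \<C>) (\<T> \<odot> \<C>) \<and>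
    s\<^sub>T \<in> hom P \<T> \<and> functional K s\<^sub>T \<and>
    s\<^sub>C \<in> hom (P \<odot> \<C>) \<C> \<and>
    s = (s\<^sub>T \<otimes> s\<^sub>C) \<cdot> \<alpha> P P \<C> \<cdot> (copy P \<otimes> \<i>\<d> \<C>) \<and>
    (\<i>\<d> \<T> \<otimes> del \<C>) \<cdot> s = s\<^sub>T \<otimes> del \<C> \<and>
    \<ll> \<C> \<cdot> (del \<T> \<otimes> \<i>\<d> \<C>) \<cdot> s = s\<^sub>C"

definition simulator :: "'o \<Rightarrow> 'm \<Rightarrow> bool"
  where "simulator P s \<longleftrightarrow> (\<exists>s\<^sub>T s\<^sub>C. simulator_via P s s\<^sub>T s\<^sub>C)"

definition trivial_simulator :: "'m"
  where "trivial_simulator = \<i>\<d> (\<T> \<odot> \<C>)"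

definition lax_reduction_to_trivial :: "'o \<Rightarrow> 'm \<Rightarrow> 'm \<Rightarrow> bool"
  where "lax_reduction_to_trivial P s r \<longleftrightarrow>
    r \<in> hom \<T> P \<and> functional K r \<and> s \<cdot> (r \<otimes> \<i>\<d> \<C>) \<succeq> \<i>\<d> (\<T> \<odot> \<C>)"

definition universal :: "'o \<Rightarrow> 'm \<Rightarrow> bool"
  where "universal P s \<longleftrightarrow> (\<exists>r. lax_reduction_to_trivial P s r)"

text \<open>
  The equations for a simulator need not determine its compiler; being compressed refers to some
  compiler, chosen once for all lax reductions.
\<close>

definition compressed :: "'o \<Rightarrow> 'm \<Rightarrow> bool"
  where "compressed P s \<longleftrightarrow>
    universal P s \<and>
    (\<exists>s\<^sub>T s\<^sub>C. simulator_via P s s\<^sub>T s\<^sub>C \<and>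
      (\<forall>r. lax_reduction_to_trivial P s r \<longrightarrow>
        (\<exists>t g. t \<in> hom \<I> \<T> \<and> functional K t \<and> g \<in> hom \<I> \<T> \<and> functional K g \<and>
          s\<^sub>T \<cdot> r \<cdot> t = s\<^sub>T \<cdot> r \<cdot> g \<and>
          \<not> (\<exists>v \<in> hom \<C> \<C>. g \<otimes> \<i>\<d> \<C> \<succeq> t \<otimes> v))))"

definition simulator_morphism :: "'o \<Rightarrow> 'm \<Rightarrow> 'o \<Rightarrow> 'm \<Rightarrow> 'm \<Rightarrow> 'm \<Rightarrow> bool"
  where "simulator_morphism P s P' s' r q \<longleftrightarrow>
    r \<in> hom P' P \<and> functional K r \<and>
    simulator (P' \<odot> \<T>) q \<and>
    \<ll> (\<T> \<odot> \<C>) \<cdot> (del P' \<otimes> \<i>\<d> (\<T> \<odot> \<C>)) \<cdot> \<alpha> P' \<T> \<C> \<succeq> q \<and>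
    s' = q \<cdot> (inv (\<alpha> P' \<T> \<C>)) \<cdot> (\<i>\<d> P' \<otimes> (s \<cdot> (r \<otimes> \<i>\<d> \<C>)))
           \<cdot> \<alpha> P' P' \<C> \<cdot> (copy P' \<otimes> \<i>\<d> \<C>)"

end

end

theory Submission
  imports Defs
begin

text \<open>
  Let \<open>(r, q)\<close> be a morphism from \<open>s\<close> to the trivial simulator. Deleting the first program in the
  defining equation shows that \<open>r\<close> is a lax reduction, so \<open>f = s \<cdot> (r \<otimes> id)\<close> satisfies \<open>id \<succeq> f\<close>.
  Take states \<open>t\<close>, \<open>g\<close> with the same compiled code \<open>u\<close>. The decoder \<open>q\<close> applied to \<open>t\<close> and the
  output of \<open>f\<close> on \<open>t\<close> returns \<open>t \<otimes> id\<close>, and its target part \<open>w\<close> only depends on \<open>t\<close> and \<open>u\<close>.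
  Feeding it with \<open>t\<close> and the output of \<open>f\<close> on \<open>g\<close> therefore gives \<open>w \<otimes> v = t \<otimes> v\<close>, while
  \<open>g \<otimes> id \<succeq> f \<cdot> (g \<otimes> id)\<close>, which in turn lies above this decoded arrow. The state \<open>t\<close> need not be
  total, so the last comparison passes through a restriction by the scalar \<open>del \<cdot> t\<close>.
\<close>

section \<open>Composition and inverses in a category\<close>

context gs_category
begin

lemma homD: "f \<in> hom A B \<Longrightarrow> f \<in> Arr K \<and> src K f = A \<and> tgt K f = B \<and> A \<in> Obj K \<and> B \<in> Obj K"
  using src_obj tgt_obj by (auto simp: hom_set_def)

lemma hom_iff: "f \<in> hom A B \<longleftrightarrow> f \<in> Arr K \<and> src K f = A \<and> tgt K f = B"
  by (simp add: hom_set_def)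

lemma arr_hom: "f \<in> Arr K \<Longrightarrow> f \<in> hom (src K f) (tgt K f)"
  by (simp add: hom_set_def)

lemma ident_arr [simp]:
  assumes "A \<in> Obj K"
  shows "\<i>\<d> A \<in> Arr K" "src K (\<i>\<d> A) = A" "tgt K (\<i>\<d> A) = A"
  using homD[OF ident_hom[OF assms]] by auto

lemma comp_arr [simp]:
  assumes "f \<in> Arr K" "g \<in> Arr K" "src K g = tgt K f"
  shows "g \<cdot> f \<in> Arr K" "src K (g \<cdot> f) = src K f" "tgt K (g \<cdot> f) = tgt K g"
  using comp_hom[of f "src K f" "tgt K f" g "tgt K g"] assms by (auto simp: hom_iff)

lemma arr_obj [simp]:
  assumes "f \<in> Arr K"
  shows "src K f \<in> Obj K" "tgt K f \<in> Obj K"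
  using assms src_obj tgt_obj by auto

lemma ident_comp [simp]:
  assumes "f \<in> Arr K"
  shows "tgt K f = B \<Longrightarrow> \<i>\<d> B \<cdot> f = f" "src K f = A \<Longrightarrow> f \<cdot> \<i>\<d> A = f"
  using comp_ident_left comp_ident_right arr_hom[OF assms] by auto

lemma assoc_arr [simp]:
  assumes "f \<in> Arr K" "g \<in> Arr K" "h \<in> Arr K" "src K g = tgt K f" "src K h = tgt K g"
  shows "(h \<cdot> g) \<cdot> f = h \<cdot> g \<cdot> f"
  using comp_assoc[of f "src K f" "tgt K f" g "tgt K g" h "tgt K h"] assms by (auto simp: hom_iff)

text \<open>Two inverses \<open>g\<close>, \<open>g'\<close> of \<open>f\<close> agree because
  \<open>g' = (g \<cdot> f) \<cdot> g'\<close>, so the definite description behind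
  \<open>inv f\<close> denotes.\<close>

lemma inverse_arrs_inv:
  assumes "is_iso K f"
  shows "inverse_arrs K f (inv f)"
proof -
  obtain g where g: "inverse_arrs K f g"
    using assms by (auto simp: is_iso_def)
  have "g' = g" if g': "inverse_arrs K f g'" for g'
  proof -
    have a: "f \<in> Arr K" "g \<in> Arr K" "g' \<in> Arr K" "src K g = tgt K f" "tgt K g = src K f"
      "src K g' = tgt K f" "tgt K g' = src K f"
      using g g' by (auto simp: inverse_arrs_def hom_iff)
    have "g' = (g \<cdot> f) \<cdot> g'"
      using g a by (simp add: inverse_arrs_def del: assoc_arr)
    also have "\<dots> = g"
      using g' a by (simp add: inverse_arrs_def)
    finally show ?thesis .
  qed
  then show ?thesis
    unfolding inv_arr_def using g by (metis (no_types, lifting) theI)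
qed

lemma inv_arr [simp]:
  assumes "is_iso K f"
  shows "inv f \<in> Arr K" "src K (inv f) = tgt K f" "tgt K (inv f) = src K f"
    "inv f \<cdot> f = \<i>\<d> (src K f)" "f \<cdot> inv f = \<i>\<d> (tgt K f)"
  using inverse_arrs_inv[OF assms] by (auto simp: inverse_arrs_def hom_iff)

lemma iso_arr: "is_iso K f \<Longrightarrow> f \<in> Arr K"
  by (auto simp: is_iso_def inverse_arrs_def)

lemma inv_comp_cancel [simp]:
  assumes "is_iso K f" "x \<in> Arr K"
  shows "tgt K x = src K f \<Longrightarrow> inv f \<cdot> f \<cdot> x = x"
    and "tgt K x = tgt K f \<Longrightarrow> f \<cdot> inv f \<cdot> x = x"
  using assms iso_arr[OF assms(1)]
  by (simp_all del: assoc_arr add: assoc_arr[symmetric])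

lemma iso_cancel_left:
  assumes "is_iso K f" "x \<in> Arr K" "y \<in> Arr K" "tgt K x = src K f" "tgt K y = src K f"
    "f \<cdot> x = f \<cdot> y"
  shows "x = y"
  using inv_comp_cancel(1)[OF assms(1,2,4)] inv_comp_cancel(1)[OF assms(1,3,5)] assms(6) by metis

lemma iso_cancel_right:
  assumes "is_iso K f" "x \<in> Arr K" "y \<in> Arr K" "src K x = tgt K f" "src K y = tgt K f"
    "x \<cdot> f = y \<cdot> f"
  shows "x = y"
proof -
  have "(x \<cdot> f) \<cdot> inv f = (y \<cdot> f) \<cdot> inv f"
    using assms(6) by simp
  then show ?thesis
    using assms(1-5) iso_arr[OF assms(1)] by simp
qed

text \<open>Transfers naturality squares of associators and unitors to their inverses.\<close>

lemma iso_conjugate: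
  assumes "is_iso K a" "is_iso K b" "x \<in> Arr K" "y \<in> Arr K" "src K x = src K b" "tgt K x = src K a"
    "src K y = tgt K b" "tgt K y = tgt K a" "a \<cdot> x = y \<cdot> b"
  shows "x \<cdot> inv b = inv a \<cdot> y"
proof (rule iso_cancel_right[OF assms(2)])
  have "(x \<cdot> inv b) \<cdot> b = inv a \<cdot> a \<cdot> x"
    using assms(1-8) iso_arr[OF assms(1)] iso_arr[OF assms(2)] by simp
  also have "\<dots> = (inv a \<cdot> y) \<cdot> b"
    using assms(1-8) iso_arr[OF assms(1)] iso_arr[OF assms(2)] by (simp only: assms(9)) simp
  finally show "(x \<cdot> inv b) \<cdot> b = (inv a \<cdot> y) \<cdot> b" .
qed (use assms(1-8) iso_arr[OF assms(1)] iso_arr[OF assms(2)] in simp_all)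

end

section \<open>Naturality and coherence in a symmetric monoidal category\<close>

context symmetric_monoidal_category
begin

lemma tensor_arr [simp]:
  assumes "f \<in> Arr K" "g \<in> Arr K"
  shows "f \<otimes> g \<in> Arr K" "src K (f \<otimes> g) = src K f \<odot> src K g"
    "tgt K (f \<otimes> g) = tgt K f \<odot> tgt K g"
  using tensor_hom[OF arr_hom[OF assms(1)] arr_hom[OF assms(2)]] by (auto simp: hom_iff)

declare unit_obj [simp] tensor_obj [simp] tensor_ident [simp]

lemma associator_arr [simp]:
  assumes "A \<in> Obj K" "B \<in> Obj K" "D \<in> Obj K"
  shows "\<alpha> A B D \<in> Arr K" "src K (\<alpha> A B D) = (A \<odot> B) \<odot> D" "tgt K (\<alpha> A B D) = A \<odot> B \<odot> D"
    "is_iso K (\<alpha> A B D)"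
  using assms associator_hom associator_iso by (auto simp: hom_iff)

lemma braiding_arr [simp]:
  assumes "A \<in> Obj K" "B \<in> Obj K"
  shows "\<sigma> A B \<in> Arr K" "src K (\<sigma> A B) = A \<odot> B" "tgt K (\<sigma> A B) = B \<odot> A"
  using assms braiding_hom by (auto simp: hom_iff)

lemma unitor_arr [simp]:
  assumes "A \<in> Obj K"
  shows "\<ll> A \<in> Arr K" "src K (\<ll> A) = \<I> \<odot> A" "tgt K (\<ll> A) = A" "is_iso K (\<ll> A)"
    "\<rr> A \<in> Arr K" "src K (\<rr> A) = A \<odot> \<I>" "tgt K (\<rr> A) = A" "is_iso K (\<rr> A)"
  using assms lunitor_hom lunitor_iso runitor_hom runitor_iso by (auto simp: hom_iff)

lemma tensor_comp [simp]:
  assumes "f \<in> Arr K" "g \<in> Arr K" "f' \<in> Arr K" "g' \<in> Arr K" "src K g = tgt K f" "src K g' = tgt K f'"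
  shows "(g \<otimes> g') \<cdot> (f \<otimes> f') = (g \<cdot> f) \<otimes> (g' \<cdot> f')"
  using interchange[of f "src K f" "tgt K f" g "tgt K g" f' "src K f'" "tgt K f'" g' "tgt K g'"]
    assms by (auto simp: hom_iff)

lemma tensor_comp_assoc [simp]:
  assumes "f \<in> Arr K" "g \<in> Arr K" "f' \<in> Arr K" "g' \<in> Arr K" "src K g = tgt K f" "src K g' = tgt K f'"
    "x \<in> Arr K" "tgt K x = src K f \<odot> src K f'"
  shows "(g \<otimes> g') \<cdot> (f \<otimes> f') \<cdot> x = ((g \<cdot> f) \<otimes> (g' \<cdot> f')) \<cdot> x"
  using assms assoc_arr[of x "f \<otimes> f'" "g \<otimes> g'"] by simp

lemma associator_nat:
  assumes "f \<in> Arr K" "g \<in> Arr K" "h \<in> Arr K"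
  shows "\<alpha> (tgt K f) (tgt K g) (tgt K h) \<cdot> ((f \<otimes> g) \<otimes> h) =
    (f \<otimes> (g \<otimes> h)) \<cdot> \<alpha> (src K f) (src K g) (src K h)"
  using assms associator_natural arr_hom by blast

lemma inv_associator_nat:
  assumes "f \<in> Arr K" "g \<in> Arr K" "h \<in> Arr K"
  shows "inv (\<alpha> (tgt K f) (tgt K g) (tgt K h)) \<cdot> (f \<otimes> (g \<otimes> h)) =
    ((f \<otimes> g) \<otimes> h) \<cdot> inv (\<alpha> (src K f) (src K g) (src K h))"
  by (rule iso_conjugate[OF _ _ _ _ _ _ _ _ associator_nat[OF assms], symmetric])
    (simp_all add: assms)

lemma lunitor_nat:
  assumes "f \<in> Arr K"
  shows "\<ll> (tgt K f) \<cdot> (\<i>\<d> \<I> \<otimes> f) = f \<cdot> \<ll> (src K f)"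
  using assms lunitor_natural arr_hom by blast

lemma inv_lunitor_nat:
  assumes "f \<in> Arr K"
  shows "(\<i>\<d> \<I> \<otimes> f) \<cdot> inv (\<ll> (src K f)) = inv (\<ll> (tgt K f)) \<cdot> f"
  by (rule iso_conjugate[OF _ _ _ _ _ _ _ _ lunitor_nat[OF assms]]) (simp_all add: assms)

lemma braiding_nat:
  assumes "f \<in> Arr K" "g \<in> Arr K"
  shows "\<sigma> (tgt K f) (tgt K g) \<cdot> (f \<otimes> g) = (g \<otimes> f) \<cdot> \<sigma> (src K f) (src K g)"
  using assms braiding_natural arr_hom by blast

lemma iso_tensor:
  assumes "is_iso K f" "is_iso K g"
  shows "is_iso K (f \<otimes> g)"
proof -
  have "inverse_arrs K (f \<otimes> g) (inv f \<otimes> inv g)"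
    using assms iso_arr[OF assms(1)] iso_arr[OF assms(2)]
    by (simp add: inverse_arrs_def hom_iff)
  then show ?thesis
    by (auto simp: is_iso_def)
qed

lemma iso_ident: "A \<in> Obj K \<Longrightarrow> is_iso K (\<i>\<d> A)"
  unfolding is_iso_def inverse_arrs_def hom_iff by (intro exI[of _ "\<i>\<d> A"]) simp

text \<open>By naturality, the left unitor conjugates \<open>\<i>\<d> \<I> \<otimes> x\<close> into
  \<open>x\<close>. Equations may therefore be checked after tensoring with the unit.\<close>

lemma ident_unit_tensor_faithful:
  assumes "x \<in> Arr K" "y \<in> Arr K" "src K x = src K y" "tgt K x = tgt K y"
    "\<i>\<d> \<I> \<otimes> x = \<i>\<d> \<I> \<otimes> y"
  shows "x = y"
proof (rule iso_cancel_right[of "\<ll> (src K x)"])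
  show "x \<cdot> \<ll> (src K x) = y \<cdot> \<ll> (src K x)"
    using lunitor_nat[OF assms(1)] lunitor_nat[OF assms(2)] assms(3-5) by metis
qed (use assms(1-4) in simp_all)

text \<open>Kelly's redundancy: this coherence law follows from the triangle and the pentagon.\<close>

lemma lunitor_tensor:
  assumes [simp]: "A \<in> Obj K" "B \<in> Obj K"
  shows "\<ll> (A \<odot> B) \<cdot> \<alpha> \<I> A B = \<ll> A \<otimes> \<i>\<d> B"
proof (rule ident_unit_tensor_faithful)
  let ?X = "\<i>\<d> \<I> \<otimes> (\<ll> (A \<odot> B) \<cdot> \<alpha> \<I> A B)" and ?Y = "\<i>\<d> \<I> \<otimes> (\<ll> A \<otimes> \<i>\<d> B)"
  let ?a = "\<alpha> \<I> (\<I> \<odot> A) B" and ?b = "\<alpha> \<I> \<I> A \<otimes> \<i>\<d> B"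
  \<comment> \<open>The isomorphisms \<open>?a\<close> and \<open>?b\<close> are appended so that
    the pentagon for \<open>\<I>\<close>, \<open>\<I>\<close>, \<open>A\<close>, \<open>B\<close>
    applies; they are cancelled at the end.\<close>
  have "?X \<cdot> ?a \<cdot> ?b = (\<i>\<d> \<I> \<otimes> \<ll> (A \<odot> B)) \<cdot> (\<i>\<d> \<I> \<otimes> \<alpha> \<I> A B) \<cdot> ?a \<cdot> ?b"
    by simp
  also have "\<dots> = (\<i>\<d> \<I> \<otimes> \<ll> (A \<odot> B)) \<cdot> \<alpha> \<I> \<I> (A \<odot> B) \<cdot> \<alpha> (\<I> \<odot> \<I>) A B"
    by (simp only: pentagon unit_obj assms)
  also have "\<dots> = ((\<i>\<d> \<I> \<otimes> \<ll> (A \<odot> B)) \<cdot> \<alpha> \<I> \<I> (A \<odot> B)) \<cdot> \<alpha> (\<I> \<odot> \<I>) A B"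
    by simp
  also have "\<dots> = (\<rr> \<I> \<otimes> (\<i>\<d> A \<otimes> \<i>\<d> B)) \<cdot> \<alpha> (\<I> \<odot> \<I>) A B"
    by (subst triangle) simp_all
  also have "\<dots> = \<alpha> \<I> A B \<cdot> ((\<rr> \<I> \<otimes> \<i>\<d> A) \<otimes> \<i>\<d> B)"
    using associator_nat[of "\<rr> \<I>" "\<i>\<d> A" "\<i>\<d> B"] by simp
  also have "\<dots> = \<alpha> \<I> A B \<cdot> ((\<i>\<d> \<I> \<otimes> \<ll> A) \<otimes> \<i>\<d> B) \<cdot> ?b"
    by (simp add: triangle)
  also have "\<dots> = (\<alpha> \<I> A B \<cdot> ((\<i>\<d> \<I> \<otimes> \<ll> A) \<otimes> \<i>\<d> B)) \<cdot> ?b"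
    by (simp del: tensor_comp tensor_comp_assoc)
  also have "\<dots> = (?Y \<cdot> ?a) \<cdot> ?b"
    using associator_nat[of "\<i>\<d> \<I>" "\<ll> A" "\<i>\<d> B"] by simp
  also have "\<dots> = ?Y \<cdot> ?a \<cdot> ?b"
    by simp
  finally have "(?X \<cdot> ?a) \<cdot> ?b = (?Y \<cdot> ?a) \<cdot> ?b"
    by simp
  then have "?X \<cdot> ?a = ?Y \<cdot> ?a"
    by (rule iso_cancel_right[rotated -1]) (simp_all add: iso_tensor iso_ident)
  then show "?X = ?Y"
    by (rule iso_cancel_right[rotated -1]) simp_all
qed simp_all

lemma inv_lunitor_tensor:
  assumes [simp]: "A \<in> Obj K" "B \<in> Obj K"
  shows "\<alpha> \<I> A B \<cdot> (inv (\<ll> A) \<otimes> \<i>\<d> B) = inv (\<ll> (A \<odot> B))"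
proof (rule iso_cancel_left[of "\<ll> (A \<odot> B)"])
  have "\<ll> (A \<odot> B) \<cdot> \<alpha> \<I> A B \<cdot> (inv (\<ll> A) \<otimes> \<i>\<d> B) =
      (\<ll> (A \<odot> B) \<cdot> \<alpha> \<I> A B) \<cdot> (inv (\<ll> A) \<otimes> \<i>\<d> B)"
    by simp
  also have "\<dots> = \<ll> (A \<odot> B) \<cdot> inv (\<ll> (A \<odot> B))"
    by (simp add: lunitor_tensor)
  finally show "\<ll> (A \<odot> B) \<cdot> \<alpha> \<I> A B \<cdot> (inv (\<ll> A) \<otimes> \<i>\<d> B) = \<ll> (A \<odot> B) \<cdot> inv (\<ll> (A \<odot> B))" .
qed simp_all

text \<open>Naturality of the left unitor at \<open>\<ll> A\<close> itself, followed by cancelling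
  \<open>\<ll> A\<close>, identifies the two unitors on
  \<open>\<I> \<odot> \<I> \<odot> A\<close>.\<close>

lemma inv_lunitor_unit_tensor:
  assumes [simp]: "A \<in> Obj K"
  shows "inv (\<ll> (\<I> \<odot> A)) = \<i>\<d> \<I> \<otimes> inv (\<ll> A)"
proof -
  have "\<ll> (\<I> \<odot> A) = \<i>\<d> \<I> \<otimes> \<ll> A"
    by (rule iso_cancel_left[of "\<ll> A"]) (use lunitor_nat[of "\<ll> A"] in simp_all)
  then have "\<ll> (\<I> \<odot> A) \<cdot> (\<i>\<d> \<I> \<otimes> inv (\<ll> A)) = \<i>\<d> (\<I> \<odot> A)"
    by simp
  then show ?thesis
    by (intro iso_cancel_left[of "\<ll> (\<I> \<odot> A)" "inv (\<ll> (\<I> \<odot> A))"]) simp_all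
qed

section \<open>Scalars and the middle swap\<close>

text \<open>The action of a scalar, an endomorphism of the unit, on an object. It is applied to
  \<open>del \<T> \<cdot> t\<close>, which records the failure of a state \<open>t\<close> to be
  total.\<close>

definition scale :: "'b \<Rightarrow> 'a \<Rightarrow> 'b"
  where "scale e A = \<ll> A \<cdot> (e \<otimes> \<i>\<d> A) \<cdot> inv (\<ll> A)"

lemma scale_arr [simp]:
  assumes "e \<in> hom \<I> \<I>" "A \<in> Obj K"
  shows "scale e A \<in> Arr K" "src K (scale e A) = A" "tgt K (scale e A) = A"
  using assms by (auto simp: scale_def hom_iff)

text \<open>Scalars are central: \<open>e\<close> and \<open>f\<close> act on different tensor
  factors, and the unitors are natural.\<close>

lemma scale_nat:
  assumes e: "e \<in> hom \<I> \<I>" and [simp]: "f \<in> Arr K"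
  shows "scale e (tgt K f) \<cdot> f = f \<cdot> scale e (src K f)"
proof -
  have [simp]: "e \<in> Arr K" "src K e = \<I>" "tgt K e = \<I>"
    using e by (auto simp: hom_iff)
  have "scale e (tgt K f) \<cdot> f = \<ll> (tgt K f) \<cdot> (e \<otimes> \<i>\<d> (tgt K f)) \<cdot> (\<i>\<d> \<I> \<otimes> f) \<cdot> inv (\<ll> (src K f))"
    by (simp add: scale_def inv_lunitor_nat del: tensor_comp tensor_comp_assoc)
  also have "\<dots> = (\<ll> (tgt K f) \<cdot> (\<i>\<d> \<I> \<otimes> f)) \<cdot> (e \<otimes> \<i>\<d> (src K f)) \<cdot> inv (\<ll> (src K f))"
    by simp
  also have "\<dots> = f \<cdot> scale e (src K f)"
    by (simp add: scale_def lunitor_nat del: tensor_comp tensor_comp_assoc)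
  finally show ?thesis .
qed

lemma scale_tensor_left:
  assumes e: "e \<in> hom \<I> \<I>" and [simp]: "A \<in> Obj K" "B \<in> Obj K"
  shows "scale e A \<otimes> \<i>\<d> B = scale e (A \<odot> B)"
proof -
  have [simp]: "e \<in> Arr K" "src K e = \<I>" "tgt K e = \<I>"
    using e by (auto simp: hom_iff)
  have "scale e A \<otimes> \<i>\<d> B = (\<ll> A \<otimes> \<i>\<d> B) \<cdot> ((e \<otimes> \<i>\<d> A) \<otimes> \<i>\<d> B) \<cdot> (inv (\<ll> A) \<otimes> \<i>\<d> B)"
    by (simp add: scale_def)
  also have "\<dots> = \<ll> (A \<odot> B) \<cdot> (\<alpha> \<I> A B \<cdot> ((e \<otimes> \<i>\<d> A) \<otimes> \<i>\<d> B)) \<cdot> (inv (\<ll> A) \<otimes> \<i>\<d> B)"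
    by (simp flip: lunitor_tensor)
  also have "\<dots> = \<ll> (A \<odot> B) \<cdot> (e \<otimes> \<i>\<d> (A \<odot> B)) \<cdot> \<alpha> \<I> A B \<cdot> (inv (\<ll> A) \<otimes> \<i>\<d> B)"
    using associator_nat[of e "\<i>\<d> A" "\<i>\<d> B"] by simp
  finally show ?thesis
    by (simp add: inv_lunitor_tensor scale_def)
qed

text \<open>The braiding commutes with scalars, which reduces this to
  \<open>scale_tensor_left\<close>.\<close>

lemma scale_tensor_right:
  assumes e: "e \<in> hom \<I> \<I>" and [simp]: "A \<in> Obj K" "B \<in> Obj K"
  shows "\<i>\<d> A \<otimes> scale e B = scale e (A \<odot> B)"
proof -
  note [simp] = scale_arr[OF e]
  have "\<sigma> A B \<cdot> (\<i>\<d> A \<otimes> scale e B) = (scale e B \<otimes> \<i>\<d> A) \<cdot> \<sigma> A B"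
    using braiding_nat[of "\<i>\<d> A" "scale e B"] by simp
  also have "\<dots> = \<sigma> A B \<cdot> scale e (A \<odot> B)"
    using scale_nat[OF e, of "\<sigma> A B"] by (simp add: scale_tensor_left[OF e])
  finally have "(\<sigma> B A \<cdot> \<sigma> A B) \<cdot> (\<i>\<d> A \<otimes> scale e B) = (\<sigma> B A \<cdot> \<sigma> A B) \<cdot> scale e (A \<odot> B)"
    by simp
  then show ?thesis
    by (simp add: braiding_symmetric del: assoc_arr)
qed

text \<open>The arrows \<open>f\<close> and \<open>g\<close> slide through one structural
  isomorphism at a time, first through the inner reshuffle \<open>?m\<close> and then through the
  outer associators.\<close>

lemma middle_swap_nat:
  assumes [simp]: "f \<in> Arr K" "g \<in> Arr K"
  shows "middle_swap K (tgt K f) (tgt K g) \<cdot> ((f \<otimes> f) \<otimes> (g \<otimes> g)) =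
    ((f \<otimes> g) \<otimes> (f \<otimes> g)) \<cdot> middle_swap K (src K f) (src K g)"
proof -
  let ?A = "src K f" and ?B = "src K g" and ?A' = "tgt K f" and ?B' = "tgt K g"
  let ?m = "\<lambda>A B. \<alpha> B A B \<cdot> (\<sigma> A B \<otimes> \<i>\<d> B) \<cdot> inv (\<alpha> A B B)"
  have "?m ?A' ?B' \<cdot> (f \<otimes> (g \<otimes> g)) =
      \<alpha> ?B' ?A' ?B' \<cdot> ((\<sigma> ?A' ?B' \<cdot> (f \<otimes> g)) \<otimes> g) \<cdot> inv (\<alpha> ?A ?B ?B)"
    by (simp add: inv_associator_nat)
  also have "\<dots> = (\<alpha> ?B' ?A' ?B' \<cdot> ((g \<otimes> f) \<otimes> g)) \<cdot> (\<sigma> ?A ?B \<otimes> \<i>\<d> ?B) \<cdot> inv (\<alpha> ?A ?B ?B)"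
    by (simp add: braiding_nat)
  also have "\<dots> = (g \<otimes> (f \<otimes> g)) \<cdot> ?m ?A ?B"
    unfolding associator_nat[OF assms(2,1,2)] by simp
  finally have m: "?m ?A' ?B' \<cdot> (f \<otimes> (g \<otimes> g)) = (g \<otimes> (f \<otimes> g)) \<cdot> ?m ?A ?B" .
  define M where "M = ?m ?A ?B"
  define M' where "M' = ?m ?A' ?B'"
  have [simp]: "M \<in> Arr K" "src K M = ?A \<odot> ?B \<odot> ?B" "tgt K M = ?B \<odot> ?A \<odot> ?B"
    "M' \<in> Arr K" "src K M' = ?A' \<odot> ?B' \<odot> ?B'" "tgt K M' = ?B' \<odot> ?A' \<odot> ?B'"
    by (simp_all add: M_def M'_def)
  have ms: "middle_swap K ?A ?B = inv (\<alpha> ?A ?B (?A \<odot> ?B)) \<cdot> (\<i>\<d> ?A \<otimes> M) \<cdot> \<alpha> ?A ?A (?B \<odot> ?B)"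
    "middle_swap K ?A' ?B' = inv (\<alpha> ?A' ?B' (?A' \<odot> ?B')) \<cdot> (\<i>\<d> ?A' \<otimes> M') \<cdot> \<alpha> ?A' ?A' (?B' \<odot> ?B')"
    by (simp_all only: middle_swap_def M_def M'_def)
  have "middle_swap K ?A' ?B' \<cdot> ((f \<otimes> f) \<otimes> (g \<otimes> g)) =
      inv (\<alpha> ?A' ?B' (?A' \<odot> ?B')) \<cdot> (\<i>\<d> ?A' \<otimes> M') \<cdot>
      (\<alpha> ?A' ?A' (?B' \<odot> ?B') \<cdot> ((f \<otimes> f) \<otimes> (g \<otimes> g)))"
    by (simp add: ms)
  also have "\<dots> = inv (\<alpha> ?A' ?B' (?A' \<odot> ?B')) \<cdot> (f \<otimes> (M' \<cdot> (f \<otimes> (g \<otimes> g)))) \<cdot> \<alpha> ?A ?A (?B \<odot> ?B)"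
    using associator_nat[of f f "g \<otimes> g"] by simp
  also have "\<dots> = (inv (\<alpha> ?A' ?B' (?A' \<odot> ?B')) \<cdot> (f \<otimes> (g \<otimes> (f \<otimes> g)))) \<cdot>
      (\<i>\<d> ?A \<otimes> M) \<cdot> \<alpha> ?A ?A (?B \<odot> ?B)"
    using m[folded M_def M'_def] by simp
  also have "\<dots> = ((f \<otimes> g) \<otimes> (f \<otimes> g)) \<cdot> middle_swap K ?A ?B"
    using inv_associator_nat[of f g "f \<otimes> g"] by (simp add: ms del: tensor_comp tensor_comp_assoc)
  finally show ?thesis .
qed

end

section \<open>Copying, functional states and restriction by scalars\<close>

context gs_monoidal_category
begin

lemma copy_del_arr [simp]:
  assumes "A \<in> Obj K"
  shows "copy A \<in> Arr K" "src K (copy A) = A" "tgt K (copy A) = A \<odot> A"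
    "del A \<in> Arr K" "src K (del A) = A" "tgt K (del A) = \<I>"
  using assms copy_hom del_hom by (auto simp: hom_iff)

lemma copy_unit: "copy \<I> = inv (\<ll> \<I>)"
proof (rule iso_cancel_left[of "\<ll> \<I>"])
  show "\<ll> \<I> \<cdot> copy \<I> = \<ll> \<I> \<cdot> inv (\<ll> \<I>)"
    using copy_counit_left[of "\<I>"] by (simp add: del_unit)
qed simp_all

lemma runitor_copy_unit: "\<rr> \<I> \<cdot> copy \<I> = \<i>\<d> \<I>"
  using copy_counit_right[of "\<I>"] by (simp add: del_unit)

lemma iso_copy_unit: "is_iso K (copy \<I>)"
  unfolding is_iso_def inverse_arrs_def hom_iff
  by (intro exI[of _ "\<ll> \<I>"]) (simp, simp add: copy_unit)

text \<open>Commutativity gives \<open>\<sigma> \<I> \<I> \<cdot> copy \<I> = copy \<I>\<close>, and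
  \<open>copy \<I>\<close> is invertible, being an inverse unitor.\<close>

lemma braiding_unit: "\<sigma> \<I> \<I> = \<i>\<d> (\<I> \<odot> \<I>)"
  by (rule iso_cancel_right[OF iso_copy_unit]) (simp_all add: copy_commutative)

lemma middle_swap_unit: "middle_swap K \<I> \<I> = \<i>\<d> ((\<I> \<odot> \<I>) \<odot> \<I> \<odot> \<I>)"
  by (simp add: middle_swap_def braiding_unit)

lemma copy_unit_functional: "copy (\<I> \<odot> \<I>) \<cdot> copy \<I> = (copy \<I> \<otimes> copy \<I>) \<cdot> copy \<I>"
  by (simp add: copy_tensor middle_swap_unit)

lemma functional_comp:
  assumes [simp]: "f \<in> Arr K" "g \<in> Arr K" "src K g = tgt K f"
    and f: "functional K f" and g: "functional K g"
  shows "functional K (g \<cdot> f)"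
proof -
  have "copy (tgt K g) \<cdot> g \<cdot> f = (copy (tgt K g) \<cdot> g) \<cdot> f"
    by simp
  also have "\<dots> = (g \<otimes> g) \<cdot> copy (tgt K f) \<cdot> f"
    using g by (simp add: functional_def)
  also have "\<dots> = ((g \<cdot> f) \<otimes> (g \<cdot> f)) \<cdot> copy (src K f)"
    using f by (simp add: functional_def)
  finally show ?thesis
    by (simp add: functional_def)
qed

text \<open>Copying a pair is copying both components and then swapping the middle factors. By
  naturality the swap moves past \<open>x\<close> and \<open>y\<close> to the unit object, where it
  is the identity.\<close>

lemma functional_state_pair:
  assumes x: "x \<in> hom \<I> A" "functional K x" and y: "y \<in> hom \<I> B" "functional K y"
  shows "functional K ((x \<otimes> y) \<cdot> copy \<I>)"
proof -
  have [simp]: "x \<in> Arr K" "src K x = \<I>" "tgt K x = A" "A \<in> Obj K"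
    "y \<in> Arr K" "src K y = \<I>" "tgt K y = B" "B \<in> Obj K"
    using homD[OF x(1)] homD[OF y(1)] by simp_all
  have cx: "copy A \<cdot> x = (x \<otimes> x) \<cdot> copy \<I>" and cy: "copy B \<cdot> y = (y \<otimes> y) \<cdot> copy \<I>"
    using x y by (simp_all add: functional_def)
  have [simp]: "middle_swap K A B \<in> Arr K" "src K (middle_swap K A B) = (A \<odot> A) \<odot> B \<odot> B"
    by (simp_all add: middle_swap_def)
  have "copy (A \<odot> B) \<cdot> (x \<otimes> y) \<cdot> copy \<I> = middle_swap K A B \<cdot> ((copy A \<cdot> x) \<otimes> (copy B \<cdot> y)) \<cdot> copy \<I>"
    by (simp add: copy_tensor)
  also have "\<dots> = (middle_swap K A B \<cdot> ((x \<otimes> x) \<otimes> (y \<otimes> y))) \<cdot> (copy \<I> \<otimes> copy \<I>) \<cdot> copy \<I>"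
    by (simp add: cx cy)
  also have "\<dots> = ((x \<otimes> y) \<otimes> (x \<otimes> y)) \<cdot> copy (\<I> \<odot> \<I>) \<cdot> copy \<I>"
    using middle_swap_nat[of x y] by (simp add: middle_swap_unit copy_unit_functional)
  also have "\<dots> = (((x \<otimes> y) \<cdot> copy \<I>) \<otimes> ((x \<otimes> y) \<cdot> copy \<I>)) \<cdot> copy \<I>"
    by (simp add: copy_unit_functional)
  finally show ?thesis
    by (simp add: functional_def)
qed

text \<open>Since scalars are central, the domain of \<open>k \<cdot> scale e A\<close> is
  \<open>dom_arr K k \<cdot> scale e A\<close>; normalization of \<open>k\<close> then absorbs
  \<open>dom_arr K k\<close>.\<close>

lemma extends_scale:
  assumes e: "e \<in> hom \<I> \<I>" and k: "k \<in> hom A B" "normalized K k"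
  shows "k \<sqsupseteq> k \<cdot> scale e A"
proof -
  have [simp]: "k \<in> Arr K" "src K k = A" "tgt K k = B" "A \<in> Obj K" "B \<in> Obj K"
    using homD[OF k(1)] by simp_all
  note [simp] = scale_arr[OF e]
  have "dom_arr K (k \<cdot> scale e A) =
      \<rr> A \<cdot> (\<i>\<d> A \<otimes> (del B \<cdot> k)) \<cdot> (\<i>\<d> A \<otimes> scale e A) \<cdot> copy A"
    by (simp add: dom_arr_def)
  also have "\<dots> = \<rr> A \<cdot> (\<i>\<d> A \<otimes> (del B \<cdot> k)) \<cdot> copy A \<cdot> scale e A"
    using scale_nat[OF e, of "copy A"]
    by (simp add: scale_tensor_right[OF e] del: tensor_comp tensor_comp_assoc)
  also have "\<dots> = dom_arr K k \<cdot> scale e A"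
    by (simp add: dom_arr_def)
  finally have "k \<cdot> dom_arr K (k \<cdot> scale e A) = (k \<cdot> dom_arr K k) \<cdot> scale e A"
    by (simp add: dom_arr_def)
  then show ?thesis
    using k(2) by (simp add: extends_def normalized_def)
qed

text \<open>Functionality turns copying \<open>x\<close> into preparing it twice. The copy on the
  unit object is an inverse unitor, which coherence turns into the one at
  \<open>\<I> \<odot> B\<close>.\<close>

lemma copy_state:
  assumes x: "x \<in> hom \<I> A" "functional K x" and [simp]: "B \<in> Obj K"
  shows "\<alpha> A A B \<cdot> (copy A \<otimes> \<i>\<d> B) \<cdot> (x \<otimes> \<i>\<d> B) = (x \<otimes> (x \<otimes> \<i>\<d> B)) \<cdot> inv (\<ll> (\<I> \<odot> B))"
proof -
  have [simp]: "x \<in> Arr K" "src K x = \<I>" "tgt K x = A" "A \<in> Obj K"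
    using homD[OF x(1)] by simp_all
  have cx: "copy A \<cdot> x = (x \<otimes> x) \<cdot> inv (\<ll> \<I>)"
    using x by (simp add: functional_def copy_unit)
  have "\<alpha> A A B \<cdot> (copy A \<otimes> \<i>\<d> B) \<cdot> (x \<otimes> \<i>\<d> B) =
      (\<alpha> A A B \<cdot> ((x \<otimes> x) \<otimes> \<i>\<d> B)) \<cdot> (inv (\<ll> \<I>) \<otimes> \<i>\<d> B)"
    by (simp add: cx)
  also have "\<dots> = (x \<otimes> (x \<otimes> \<i>\<d> B)) \<cdot> inv (\<ll> (\<I> \<odot> B))"
    using associator_nat[of x x "\<i>\<d> B"] inv_lunitor_tensor[of "\<I>" B] by simp
  finally show ?thesis .
qed

text \<open>
  Since \<open>v\<close> can be split off from a copy of its input that is afterwards deleted, \<open>w \<otimes> v\<close>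
  only depends on \<open>w \<otimes> del\<close>.
\<close>

lemma tensor_eq_of_tensor_del_eq:
  assumes w: "w \<in> hom \<I> A" and t: "t \<in> hom \<I> A" and v: "v \<in> hom B D"
    and eq: "w \<otimes> del B = t \<otimes> del B"
  shows "w \<otimes> v = t \<otimes> v"
proof -
  have [simp]: "v \<in> Arr K" "src K v = B" "tgt K v = D" "A \<in> Obj K" "B \<in> Obj K" "D \<in> Obj K"
    using homD[OF v] homD[OF t] by simp_all
  have "\<ll> D \<cdot> (del B \<otimes> v) \<cdot> copy B = (\<ll> D \<cdot> (\<i>\<d> \<I> \<otimes> v)) \<cdot> (del B \<otimes> \<i>\<d> B) \<cdot> copy B"
    by simp
  also have "\<dots> = v"
    using lunitor_nat[of v] copy_counit_left[of B] by (simp del: tensor_comp_assoc)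
  finally have v_eq: "\<ll> D \<cdot> (del B \<otimes> v) \<cdot> copy B = v" .
  \<comment> \<open>Only the factor \<open>x \<otimes> del B\<close> on the right involves
    \<open>x\<close>.\<close>
  have split: "x \<otimes> v = (\<i>\<d> A \<otimes> \<ll> D) \<cdot> \<alpha> A \<I> D \<cdot> ((x \<otimes> del B) \<otimes> v) \<cdot>
      inv (\<alpha> \<I> B B) \<cdot> (\<i>\<d> \<I> \<otimes> copy B)" if x: "x \<in> hom \<I> A" for x
  proof -
    have [simp]: "x \<in> Arr K" "src K x = \<I>" "tgt K x = A"
      using homD[OF x] by simp_all
    have "(\<i>\<d> A \<otimes> \<ll> D) \<cdot> \<alpha> A \<I> D \<cdot> ((x \<otimes> del B) \<otimes> v) \<cdot> inv (\<alpha> \<I> B B) \<cdot> (\<i>\<d> \<I> \<otimes> copy B) =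
        (\<i>\<d> A \<otimes> \<ll> D) \<cdot> (\<alpha> A \<I> D \<cdot> ((x \<otimes> del B) \<otimes> v)) \<cdot> inv (\<alpha> \<I> B B) \<cdot> (\<i>\<d> \<I> \<otimes> copy B)"
      by simp
    also have "\<dots> = x \<otimes> (\<ll> D \<cdot> (del B \<otimes> v) \<cdot> copy B)"
      using associator_nat[of x "del B" v] by simp
    finally show ?thesis
      by (simp add: v_eq)
  qed
  show ?thesis
    using split[OF w] split[OF t] eq by simp
qed

end

section \<open>Simulators on states and morphisms to the trivial simulator\<close>

context target_context_category
begin

declare target_obj [simp] context_obj [simp]

text \<open>A functional program state is copied into two independent states, so the output splits
  into the compiled code and a context arrow. After deleting the context only the compiled code
  remains.\<close>

lemma simulator_on_state:
  assumes s: "simulator_via K P s s\<^sub>T s\<^sub>C" and x: "x \<in> hom \<I> P" "functional K x"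
  shows "s \<cdot> (x \<otimes> \<i>\<d> \<C>) = ((s\<^sub>T \<cdot> x) \<otimes> (s\<^sub>C \<cdot> (x \<otimes> \<i>\<d> \<C>))) \<cdot> inv (\<ll> (\<I> \<odot> \<C>))"
    and "(\<i>\<d> \<T> \<otimes> del \<C>) \<cdot> s \<cdot> (x \<otimes> \<i>\<d> \<C>) = (s\<^sub>T \<cdot> x) \<otimes> del \<C>"
proof -
  have [simp]: "x \<in> Arr K" "src K x = \<I>" "tgt K x = P" "P \<in> Obj K"
    using homD[OF x(1)] by simp_all
  have [simp]: "s \<in> Arr K" "src K s = P \<odot> \<C>" "tgt K s = \<T> \<odot> \<C>"
    "s\<^sub>T \<in> Arr K" "src K s\<^sub>T = P" "tgt K s\<^sub>T = \<T>"
    "s\<^sub>C \<in> Arr K" "src K s\<^sub>C = P \<odot> \<C>" "tgt K s\<^sub>C = \<C>"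
    and s_eq: "s = (s\<^sub>T \<otimes> s\<^sub>C) \<cdot> \<alpha> P P \<C> \<cdot> (copy P \<otimes> \<i>\<d> \<C>)"
    and s_del: "(\<i>\<d> \<T> \<otimes> del \<C>) \<cdot> s = s\<^sub>T \<otimes> del \<C>"
    using s unfolding simulator_via_def hom_iff by blast+
  have "s \<cdot> (x \<otimes> \<i>\<d> \<C>) = (s\<^sub>T \<otimes> s\<^sub>C) \<cdot> \<alpha> P P \<C> \<cdot> (copy P \<otimes> \<i>\<d> \<C>) \<cdot> (x \<otimes> \<i>\<d> \<C>)"
    by (subst s_eq) (simp del: tensor_comp)
  then show "s \<cdot> (x \<otimes> \<i>\<d> \<C>) = ((s\<^sub>T \<cdot> x) \<otimes> (s\<^sub>C \<cdot> (x \<otimes> \<i>\<d> \<C>))) \<cdot> inv (\<ll> (\<I> \<odot> \<C>))"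
    using copy_state[OF x context_obj] by (simp del: tensor_comp)
  have "(\<i>\<d> \<T> \<otimes> del \<C>) \<cdot> s \<cdot> (x \<otimes> \<i>\<d> \<C>) = ((\<i>\<d> \<T> \<otimes> del \<C>) \<cdot> s) \<cdot> (x \<otimes> \<i>\<d> \<C>)"
    by simp
  also have "\<dots> = (s\<^sub>T \<cdot> x) \<otimes> del \<C>"
    by (simp add: s_del)
  finally show "(\<i>\<d> \<T> \<otimes> del \<C>) \<cdot> s \<cdot> (x \<otimes> \<i>\<d> \<C>) = (s\<^sub>T \<cdot> x) \<otimes> del \<C>" .
qed

text \<open>The comparison of the deleting projection \<open>?p\<close> with \<open>q\<close> is
  precomposed with the encoding \<open>?m\<close>, which keeps a copy of the program next to the
  output of \<open>f\<close>. Discarding that copy returns \<open>f\<close> by the counit law, and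
  decoding returns the identity.\<close>

lemma trivialization_lax_reduction:
  assumes f: "f \<in> hom (\<T> \<odot> \<C>) (\<T> \<odot> \<C>)" and q: "q \<in> hom ((\<T> \<odot> \<T>) \<odot> \<C>) (\<T> \<odot> \<C>)"
    and geq: "\<ll> (\<T> \<odot> \<C>) \<cdot> (del \<T> \<otimes> \<i>\<d> (\<T> \<odot> \<C>)) \<cdot> \<alpha> \<T> \<T> \<C> \<succeq> q"
    and triv: "\<i>\<d> (\<T> \<odot> \<C>) = q \<cdot> (inv (\<alpha> \<T> \<T> \<C>)) \<cdot> (\<i>\<d> \<T> \<otimes> f) \<cdot> \<alpha> \<T> \<T> \<C> \<cdot> (copy \<T> \<otimes> \<i>\<d> \<C>)"
  shows "f \<succeq> \<i>\<d> (\<T> \<odot> \<C>)"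
proof -
  have [simp]: "f \<in> Arr K" "src K f = \<T> \<odot> \<C>" "tgt K f = \<T> \<odot> \<C>"
    using homD[OF f] by simp_all
  let ?p = "\<ll> (\<T> \<odot> \<C>) \<cdot> (del \<T> \<otimes> \<i>\<d> (\<T> \<odot> \<C>)) \<cdot> \<alpha> \<T> \<T> \<C>"
  let ?m = "inv (\<alpha> \<T> \<T> \<C>) \<cdot> (\<i>\<d> \<T> \<otimes> f) \<cdot> \<alpha> \<T> \<T> \<C> \<cdot> (copy \<T> \<otimes> \<i>\<d> \<C>)"
  have "?p \<cdot> ?m = (\<ll> (\<T> \<odot> \<C>) \<cdot> (\<i>\<d> \<I> \<otimes> f)) \<cdot> (del \<T> \<otimes> \<i>\<d> (\<T> \<odot> \<C>)) \<cdot> \<alpha> \<T> \<T> \<C> \<cdot> (copy \<T> \<otimes> \<i>\<d> \<C>)"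
    by simp
  also have "\<dots> = f \<cdot> \<ll> (\<T> \<odot> \<C>) \<cdot> (del \<T> \<otimes> (\<i>\<d> \<T> \<otimes> \<i>\<d> \<C>)) \<cdot> \<alpha> \<T> \<T> \<C> \<cdot> (copy \<T> \<otimes> \<i>\<d> \<C>)"
    using lunitor_nat[of f] by (simp del: tensor_comp_assoc)
  also have "\<dots> = f \<cdot> \<ll> (\<T> \<odot> \<C>) \<cdot> ((del \<T> \<otimes> (\<i>\<d> \<T> \<otimes> \<i>\<d> \<C>)) \<cdot> \<alpha> \<T> \<T> \<C>) \<cdot> (copy \<T> \<otimes> \<i>\<d> \<C>)"
    by simp
  also have "\<dots> = f \<cdot> (\<ll> (\<T> \<odot> \<C>) \<cdot> \<alpha> \<I> \<T> \<C>) \<cdot> ((del \<T> \<otimes> \<i>\<d> \<T>) \<otimes> \<i>\<d> \<C>) \<cdot> (copy \<T> \<otimes> \<i>\<d> \<C>)"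
    using associator_nat[of "del \<T>" "\<i>\<d> \<T>" "\<i>\<d> \<C>", symmetric]
    by (simp del: tensor_comp tensor_comp_assoc tensor_ident)
  also have "\<dots> = f"
    by (simp add: lunitor_tensor copy_counit_left)
  finally have "?p \<cdot> ?m = f" .
  moreover have "?p \<cdot> ?m \<succeq> q \<cdot> ?m"
    by (rule geq_precomp[OF _ q _ geq]) (simp_all add: hom_iff)
  ultimately show ?thesis
    using triv by simp
qed

text \<open>This is \<open>triv\<close> evaluated at \<open>t\<close>: since \<open>t\<close> is
  functional, the decoder receives one \<open>t\<close> directly and the other through
  \<open>f\<close>.\<close>

lemma trivialization_state:
  assumes f: "f \<in> hom (\<T> \<odot> \<C>) (\<T> \<odot> \<C>)" and q: "q \<in> hom ((\<T> \<odot> \<T>) \<odot> \<C>) (\<T> \<odot> \<C>)"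
    and triv: "\<i>\<d> (\<T> \<odot> \<C>) = q \<cdot> (inv (\<alpha> \<T> \<T> \<C>)) \<cdot> (\<i>\<d> \<T> \<otimes> f) \<cdot> \<alpha> \<T> \<T> \<C> \<cdot> (copy \<T> \<otimes> \<i>\<d> \<C>)"
    and t: "t \<in> hom \<I> \<T>" "functional K t"
  shows "q \<cdot> inv (\<alpha> \<T> \<T> \<C>) \<cdot> (t \<otimes> (f \<cdot> (t \<otimes> \<i>\<d> \<C>))) \<cdot> inv (\<ll> (\<I> \<odot> \<C>)) = t \<otimes> \<i>\<d> \<C>"
proof -
  have [simp]: "f \<in> Arr K" "src K f = \<T> \<odot> \<C>" "tgt K f = \<T> \<odot> \<C>"
    "q \<in> Arr K" "src K q = (\<T> \<odot> \<T>) \<odot> \<C>" "tgt K q = \<T> \<odot> \<C>"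
    "t \<in> Arr K" "src K t = \<I>" "tgt K t = \<T>"
    using homD[OF f] homD[OF q] homD[OF t(1)] by simp_all
  have "t \<otimes> \<i>\<d> \<C> =
      (q \<cdot> (inv (\<alpha> \<T> \<T> \<C>)) \<cdot> (\<i>\<d> \<T> \<otimes> f) \<cdot> \<alpha> \<T> \<T> \<C> \<cdot> (copy \<T> \<otimes> \<i>\<d> \<C>)) \<cdot> (t \<otimes> \<i>\<d> \<C>)"
    by (simp flip: triv)
  also have "\<dots> = q \<cdot> inv (\<alpha> \<T> \<T> \<C>) \<cdot> (\<i>\<d> \<T> \<otimes> f) \<cdot> (t \<otimes> (t \<otimes> \<i>\<d> \<C>)) \<cdot> inv (\<ll> (\<I> \<odot> \<C>))"
    by (simp add: copy_state[OF t] del: tensor_comp tensor_comp_assoc)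
  finally show ?thesis
    by simp
qed

text \<open>The state \<open>x\<close> enters the target part of the output only through its
  compiled code \<open>u\<close>. Since \<open>v\<close> is not known to be total, the second claim
  is not obtained by deleting the context in the first; it uses the target marginals of
  \<open>q\<close> and \<open>s\<close> instead.\<close>

lemma trivialization_decoder_output:
  assumes s: "simulator_via K P s s\<^sub>T s\<^sub>C" and q: "simulator_via K (\<T> \<odot> \<T>) q q\<^sub>T q\<^sub>C"
    and t: "t \<in> hom \<I> \<T>" "functional K t" and x: "x \<in> hom \<I> P" "functional K x"
  defines "u \<equiv> s\<^sub>T \<cdot> x" and "n \<equiv> inv (\<alpha> \<T> \<T> \<C>) \<cdot> (t \<otimes> (s \<cdot> (x \<otimes> \<i>\<d> \<C>))) \<cdot> inv (\<ll> (\<I> \<odot> \<C>))"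
  shows "\<exists>v\<in>hom \<C> \<C>. q \<cdot> n = (q\<^sub>T \<cdot> (t \<otimes> u) \<cdot> copy \<I>) \<otimes> v"
    and "(\<i>\<d> \<T> \<otimes> del \<C>) \<cdot> q \<cdot> n = (q\<^sub>T \<cdot> (t \<otimes> u) \<cdot> copy \<I>) \<otimes> del \<C>"
proof -
  have [simp]: "t \<in> Arr K" "src K t = \<I>" "tgt K t = \<T>"
    "x \<in> Arr K" "src K x = \<I>" "tgt K x = P" "P \<in> Obj K"
    using homD[OF t(1)] homD[OF x(1)] by simp_all
  have [simp]: "s \<in> Arr K" "src K s = P \<odot> \<C>" "tgt K s = \<T> \<odot> \<C>"
    "s\<^sub>T \<in> Arr K" "src K s\<^sub>T = P" "tgt K s\<^sub>T = \<T>"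
    "s\<^sub>C \<in> Arr K" "src K s\<^sub>C = P \<odot> \<C>" "tgt K s\<^sub>C = \<C>"
    and sT: "functional K s\<^sub>T"
    using s unfolding simulator_via_def hom_iff by blast+
  have [simp]: "q \<in> Arr K" "src K q = (\<T> \<odot> \<T>) \<odot> \<C>" "tgt K q = \<T> \<odot> \<C>"
    "q\<^sub>T \<in> Arr K" "src K q\<^sub>T = \<T> \<odot> \<T>" "tgt K q\<^sub>T = \<T>"
    "q\<^sub>C \<in> Arr K" "src K q\<^sub>C = (\<T> \<odot> \<T>) \<odot> \<C>" "tgt K q\<^sub>C = \<C>"
    and q_del: "(\<i>\<d> \<T> \<otimes> del \<C>) \<cdot> q = q\<^sub>T \<otimes> del \<C>"
    using q unfolding simulator_via_def hom_iff by blast+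
  have [simp]: "u \<in> Arr K" "src K u = \<I>" "tgt K u = \<T>"
    by (simp_all add: u_def)
  have u: "u \<in> hom \<I> \<T>" "functional K u"
    using functional_comp[OF _ _ _ x(2) sT] by (simp_all add: hom_iff u_def)
  have [simp]: "n \<in> Arr K" "src K n = \<I> \<odot> \<C>" "tgt K n = (\<T> \<odot> \<T>) \<odot> \<C>"
    by (simp_all add: n_def)
  define c where "c = s\<^sub>C \<cdot> (x \<otimes> \<i>\<d> \<C>)"
  \<comment> \<open>The decoder's program is the pair \<open>y\<close> of \<open>t\<close> and the
    compiled code; \<open>w\<close> and \<open>d\<close> are the compiled target and the context
    part of \<open>q\<close> on it.\<close>
  define y where "y = (t \<otimes> u) \<cdot> copy \<I>"
  define w where "w = q\<^sub>T \<cdot> y"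
  define d where "d = q\<^sub>C \<cdot> (y \<otimes> \<i>\<d> \<C>)"
  have [simp]: "c \<in> Arr K" "src K c = \<I> \<odot> \<C>" "tgt K c = \<C>"
    "y \<in> Arr K" "src K y = \<I>" "tgt K y = \<T> \<odot> \<T>"
    by (simp_all add: c_def y_def)
  have [simp]: "w \<in> Arr K" "src K w = \<I>" "tgt K w = \<T>" "d \<in> Arr K" "src K d = \<I> \<odot> \<C>" "tgt K d = \<C>"
    by (simp_all add: w_def d_def)
  have y: "y \<in> hom \<I> (\<T> \<odot> \<T>)" "functional K y"
    using functional_state_pair[OF t u] by (simp_all add: hom_iff y_def)
  \<comment> \<open>Stated for general \<open>h\<close> because it is used both for the context
    arrow \<open>c\<close> and for \<open>del \<C>\<close>.\<close>
  have inv_assoc: "inv (\<alpha> \<T> \<T> (tgt K h)) \<cdot> (t \<otimes> (u \<otimes> h)) \<cdot> inv (\<ll> (\<I> \<odot> src K h)) = y \<otimes> h"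
    if "h \<in> Arr K" for h
  proof -
    have "inv (\<alpha> \<T> \<T> (tgt K h)) \<cdot> (t \<otimes> (u \<otimes> h)) \<cdot> inv (\<ll> (\<I> \<odot> src K h)) =
        (inv (\<alpha> \<T> \<T> (tgt K h)) \<cdot> (t \<otimes> (u \<otimes> h))) \<cdot> inv (\<ll> (\<I> \<odot> src K h))"
      using that by simp
    also have "\<dots> = ((t \<otimes> u) \<otimes> h) \<cdot> (copy \<I> \<otimes> \<i>\<d> (src K h))"
      using inv_associator_nat[of t u h] that by (simp add: copy_unit flip: inv_lunitor_tensor)
    finally show ?thesis
      using that by (simp add: y_def)
  qed
  show "\<exists>v\<in>hom \<C> \<C>. q \<cdot> n = (q\<^sub>T \<cdot> (t \<otimes> u) \<cdot> copy \<I>) \<otimes> v"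
  proof -
    let ?L = "inv (\<ll> (\<I> \<odot> \<C>))"
    let ?h = "inv (\<ll> \<C>) \<cdot> c"
    \<comment> \<open>The factor \<open>\<i>\<d> \<I> \<otimes> ?L\<close> comes from copying the
      program of \<open>s\<close>, the last \<open>?L\<close> from the definition of
      \<open>n\<close>.\<close>
    have "n = inv (\<alpha> \<T> \<T> \<C>) \<cdot> (t \<otimes> (u \<otimes> c)) \<cdot> (\<i>\<d> \<I> \<otimes> ?L) \<cdot> ?L"
      using simulator_on_state(1)[OF s x] by (simp add: n_def u_def c_def)
    also have "\<dots> = (y \<otimes> c) \<cdot> ?L"
    proof -
      have "inv (\<alpha> \<T> \<T> \<C>) \<cdot> (t \<otimes> (u \<otimes> c)) \<cdot> (\<i>\<d> \<I> \<otimes> ?L) = y \<otimes> c"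
        using inv_assoc[of c] by (simp add: inv_lunitor_unit_tensor[of "\<I> \<odot> \<C>"])
      then have "(inv (\<alpha> \<T> \<T> \<C>) \<cdot> (t \<otimes> (u \<otimes> c)) \<cdot> (\<i>\<d> \<I> \<otimes> ?L)) \<cdot> ?L = (y \<otimes> c) \<cdot> ?L"
        by simp
      then show ?thesis
        by simp
    qed
    finally have "q \<cdot> n = (q \<cdot> (y \<otimes> \<i>\<d> \<C>)) \<cdot> (\<i>\<d> \<I> \<otimes> c) \<cdot> ?L"
      by simp
    also have "\<dots> = (w \<otimes> d) \<cdot> ?L \<cdot> ?h"
      using simulator_on_state(1)[OF q y] inv_lunitor_nat[of c]
      by (simp add: w_def d_def del: tensor_comp tensor_comp_assoc)
    \<comment> \<open>Moving \<open>?h\<close> to the second factor leaves \<open>w\<close>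
      untouched, so the witness \<open>v\<close> is \<open>d\<close> applied to the context that
      \<open>s\<close> produces.\<close>
    also have "?L \<cdot> ?h = (\<i>\<d> \<I> \<otimes> ?h) \<cdot> ?L"
      using inv_lunitor_nat[of ?h] by simp
    also have "(w \<otimes> d) \<cdot> (\<i>\<d> \<I> \<otimes> ?h) \<cdot> ?L = w \<otimes> (d \<cdot> ?h \<cdot> inv (\<ll> \<C>))"
      by (simp add: inv_lunitor_unit_tensor)
    finally show ?thesis
      by (intro bexI[of _ "d \<cdot> ?h \<cdot> inv (\<ll> \<C>)"]) (simp_all add: w_def y_def hom_iff)
  qed
  have "(\<i>\<d> \<T> \<otimes> del \<C>) \<cdot> q \<cdot> n = ((\<i>\<d> \<T> \<otimes> del \<C>) \<cdot> q) \<cdot> n"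
    by simp
  also have "\<dots> = (q\<^sub>T \<otimes> \<i>\<d> \<I>) \<cdot> ((\<i>\<d> (\<T> \<odot> \<T>) \<otimes> del \<C>) \<cdot> inv (\<alpha> \<T> \<T> \<C>)) \<cdot>
      (t \<otimes> (s \<cdot> (x \<otimes> \<i>\<d> \<C>))) \<cdot> inv (\<ll> (\<I> \<odot> \<C>))"
    by (simp add: q_del n_def)
  \<comment> \<open>The deletion passes through the inverse associator and reaches \<open>s\<close>,
    whose target marginal is known on \<open>x\<close>.\<close>
  also have "\<dots> = (q\<^sub>T \<otimes> \<i>\<d> \<I>) \<cdot> inv (\<alpha> \<T> \<T> \<I>) \<cdot>
      (t \<otimes> ((\<i>\<d> \<T> \<otimes> del \<C>) \<cdot> s \<cdot> (x \<otimes> \<i>\<d> \<C>))) \<cdot> inv (\<ll> (\<I> \<odot> \<C>))"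
    using inv_associator_nat[of "\<i>\<d> \<T>" "\<i>\<d> \<T>" "del \<C>", symmetric] by simp
  also have "\<dots> = (q\<^sub>T \<otimes> \<i>\<d> \<I>) \<cdot> (y \<otimes> del \<C>)"
    using inv_assoc[of "del \<C>"] simulator_on_state(2)[OF s x] by (simp add: u_def)
  finally show "(\<i>\<d> \<T> \<otimes> del \<C>) \<cdot> q \<cdot> n = (q\<^sub>T \<cdot> (t \<otimes> u) \<cdot> copy \<I>) \<otimes> del \<C>"
    by (simp add: y_def)
qed

text \<open>Deleting \<open>t\<close> leaves the scalar \<open>del \<T> \<cdot> t\<close> acting on
  \<open>k\<close>. By \<open>extends_scale\<close> this is a restriction of \<open>k\<close>, hence
  below it.\<close>

lemma geq_restrict_by_state:
  assumes k: "k \<in> hom (\<I> \<odot> \<C>) (\<T> \<odot> \<C>)" and t: "t \<in> hom \<I> \<T>"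
  shows "k \<succeq> (\<ll> (\<T> \<odot> \<C>) \<cdot> (del \<T> \<otimes> \<i>\<d> (\<T> \<odot> \<C>)) \<cdot> \<alpha> \<T> \<T> \<C>) \<cdot>
    inv (\<alpha> \<T> \<T> \<C>) \<cdot> (t \<otimes> k) \<cdot> inv (\<ll> (\<I> \<odot> \<C>))"
    (is "_ \<succeq> ?h")
proof -
  have [simp]: "k \<in> Arr K" "src K k = \<I> \<odot> \<C>" "tgt K k = \<T> \<odot> \<C>"
    "t \<in> Arr K" "src K t = \<I>" "tgt K t = \<T>"
    using homD[OF k] homD[OF t] by simp_all
  let ?e = "del \<T> \<cdot> t"
  have e: "?e \<in> hom \<I> \<I>"
    by (simp add: hom_iff)
  have "?h = (\<ll> (\<T> \<odot> \<C>) \<cdot> (\<i>\<d> \<I> \<otimes> k)) \<cdot> (?e \<otimes> \<i>\<d> (\<I> \<odot> \<C>)) \<cdot> inv (\<ll> (\<I> \<odot> \<C>))"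
    by simp
  also have "\<dots> = k \<cdot> scale ?e (\<I> \<odot> \<C>)"
    using lunitor_nat[of k] by (simp add: scale_def del: tensor_comp tensor_comp_assoc)
  finally have h: "?h = k \<cdot> scale ?e (\<I> \<odot> \<C>)" .
  show ?thesis
    unfolding h using extends_scale[OF e k] k scale_arr[OF e]
    by (intro geq_extends[OF k]) (simp_all add: all_normalized hom_iff)
qed

text \<open>
  The program \<open>t\<close>, together with the compiled code shared by \<open>t\<close> and \<open>g\<close>, already determines the
  target component of the decoder \<open>q\<close>. Hence decoding the behaviour of \<open>g\<close> with the help of \<open>t\<close>
  yields \<open>t \<otimes> v\<close> for some \<open>v\<close>.
\<close>

lemma compression_obstructs_morphism:
  assumes s: "simulator_via K P s s\<^sub>T s\<^sub>C"
    and mor: "simulator_morphism K P s \<T> (trivial_simulator K) r q"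
    and t: "t \<in> hom \<I> \<T>" "functional K t" and g: "g \<in> hom \<I> \<T>" "functional K g"
    and eq: "s\<^sub>T \<cdot> r \<cdot> t = s\<^sub>T \<cdot> r \<cdot> g"
    and geq: "\<i>\<d> (\<T> \<odot> \<C>) \<succeq> s \<cdot> (r \<otimes> \<i>\<d> \<C>)"
  shows "\<exists>v\<in>hom \<C> \<C>. g \<otimes> \<i>\<d> \<C> \<succeq> t \<otimes> v"
proof -
  let ?f = "s \<cdot> (r \<otimes> \<i>\<d> \<C>)"
  let ?p = "\<ll> (\<T> \<odot> \<C>) \<cdot> (del \<T> \<otimes> \<i>\<d> (\<T> \<odot> \<C>)) \<cdot> \<alpha> \<T> \<T> \<C>"
  \<comment> \<open>The decoder's input: the program \<open>t\<close> next to the behaviour of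
    \<open>?f\<close> on \<open>x\<close>, which is taken to be \<open>t\<close> and then
    \<open>g\<close>.\<close>
  let ?n = "\<lambda>x. inv (\<alpha> \<T> \<T> \<C>) \<cdot> (t \<otimes> (s \<cdot> ((r \<cdot> x) \<otimes> \<i>\<d> \<C>))) \<cdot> inv (\<ll> (\<I> \<odot> \<C>))"
  have r: "r \<in> hom \<T> P" "functional K r" and p: "?p \<succeq> q"
    and triv: "\<i>\<d> (\<T> \<odot> \<C>) = q \<cdot> (inv (\<alpha> \<T> \<T> \<C>)) \<cdot> (\<i>\<d> \<T> \<otimes> ?f) \<cdot> \<alpha> \<T> \<T> \<C> \<cdot> (copy \<T> \<otimes> \<i>\<d> \<C>)"
    using mor unfolding simulator_morphism_def trivial_simulator_def by blast+
  obtain q\<^sub>T q\<^sub>C where q: "simulator_via K (\<T> \<odot> \<T>) q q\<^sub>T q\<^sub>C"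
    using mor by (auto simp: simulator_morphism_def simulator_def)
  have qh: "q \<in> hom ((\<T> \<odot> \<T>) \<odot> \<C>) (\<T> \<odot> \<C>)" and qT: "q\<^sub>T \<in> hom (\<T> \<odot> \<T>) \<T>"
    and sh: "s \<in> hom (P \<odot> \<C>) (\<T> \<odot> \<C>)" and sT: "s\<^sub>T \<in> hom P \<T>"
    using q s unfolding simulator_via_def by blast+
  have [simp]: "r \<in> Arr K" "src K r = \<T>" "tgt K r = P"
    "t \<in> Arr K" "src K t = \<I>" "tgt K t = \<T>" "g \<in> Arr K" "src K g = \<I>" "tgt K g = \<T>"
    "q \<in> Arr K" "src K q = (\<T> \<odot> \<T>) \<odot> \<C>" "tgt K q = \<T> \<odot> \<C>"
    "q\<^sub>T \<in> Arr K" "src K q\<^sub>T = \<T> \<odot> \<T>" "tgt K q\<^sub>T = \<T>"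
    "s \<in> Arr K" "src K s = P \<odot> \<C>" "tgt K s = \<T> \<odot> \<C>"
    "s\<^sub>T \<in> Arr K" "src K s\<^sub>T = P" "tgt K s\<^sub>T = \<T>"
    using homD[OF r(1)] homD[OF t(1)] homD[OF g(1)] homD[OF qh] homD[OF qT] homD[OF sh] homD[OF sT]
    by simp_all
  have f: "?f \<in> hom (\<T> \<odot> \<C>) (\<T> \<odot> \<C>)"
    by (simp add: hom_iff)
  define w where "w = q\<^sub>T \<cdot> (t \<otimes> (s\<^sub>T \<cdot> r \<cdot> t)) \<cdot> copy \<I>"
  have rt: "r \<cdot> t \<in> hom \<I> P" "functional K (r \<cdot> t)" and rg: "r \<cdot> g \<in> hom \<I> P" "functional K (r \<cdot> g)"
    using functional_comp[OF _ _ _ t(2) r(2)] functional_comp[OF _ _ _ g(2) r(2)]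
    by (simp_all add: hom_iff)
  have "w \<otimes> del \<C> = (\<i>\<d> \<T> \<otimes> del \<C>) \<cdot> q \<cdot> ?n t"
    using trivialization_decoder_output(2)[OF s q t rt] by (simp add: w_def)
  also have "q \<cdot> ?n t = t \<otimes> \<i>\<d> \<C>"
    using trivialization_state[OF f qh triv t] by simp
  finally have del_eq: "w \<otimes> del \<C> = t \<otimes> del \<C>"
    by simp
  \<comment> \<open>By \<open>eq\<close> the compiled code of \<open>g\<close> is that of
    \<open>t\<close>, so the same \<open>w\<close> appears.\<close>
  obtain v where v: "v \<in> hom \<C> \<C>" and qn: "q \<cdot> ?n g = w \<otimes> v"
    using trivialization_decoder_output(1)[OF s q t rg] eq by (auto simp: w_def)
  have wv: "w \<otimes> v = t \<otimes> v"
    by (rule tensor_eq_of_tensor_del_eq[OF _ t(1) v del_eq]) (simp add: w_def hom_iff)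
  \<comment> \<open>The chain runs from \<open>g \<otimes> \<i>\<d> \<C>\<close> through the
    behaviour of \<open>?f\<close> on \<open>g\<close> and its restriction by \<open>t\<close> down
    to \<open>q \<cdot> ?n g\<close>, which is \<open>t \<otimes> v\<close>.\<close>
  have "\<i>\<d> (\<T> \<odot> \<C>) \<cdot> (g \<otimes> \<i>\<d> \<C>) \<succeq> ?f \<cdot> (g \<otimes> \<i>\<d> \<C>)"
    by (rule geq_precomp[OF _ f _ geq]) (simp_all add: hom_iff)
  then have 1: "g \<otimes> \<i>\<d> \<C> \<succeq> s \<cdot> ((r \<cdot> g) \<otimes> \<i>\<d> \<C>)"
    by simp
  have 2: "s \<cdot> ((r \<cdot> g) \<otimes> \<i>\<d> \<C>) \<succeq> ?p \<cdot> ?n g"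
    by (rule geq_restrict_by_state[OF _ t(1)]) (simp add: hom_iff)
  have 3: "?p \<cdot> ?n g \<succeq> q \<cdot> ?n g"
    by (rule geq_precomp[OF _ qh _ p]) (simp_all add: hom_iff)
  have "g \<otimes> \<i>\<d> \<C> \<succeq> ?p \<cdot> ?n g"
    by (rule geq_trans[OF _ _ _ 1 2]) (simp_all add: hom_iff)
  then have "g \<otimes> \<i>\<d> \<C> \<succeq> q \<cdot> ?n g"
    by (rule geq_trans[OF _ _ _ _ 3, rotated -1]) (simp_all add: hom_iff)
  then show ?thesis
    using v qn wv by auto
qed

end

theorem mainTheorem3:
  fixes K :: "('o, 'm, 'e) tc_cat_scheme" (structure)
    and P :: "'o" and s :: "'m"
  assumes "target_context_category K"
    and "simulator K P s"
    and "\<And>r. r \<in> hom \<T> P \<Longrightarrow> functional K r \<Longrightarrow> s \<cdot> (r \<otimes> \<i>\<d> \<C>) \<succeq> \<i>\<d> (\<T> \<odot> \<C>)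
      \<Longrightarrow> \<i>\<d> (\<T> \<odot> \<C>) \<succeq> s \<cdot> (r \<otimes> \<i>\<d> \<C>)"
    and "compressed K P s"
  shows "\<not> (\<exists>r q. simulator_morphism K P s \<T> (trivial_simulator K) r q)"
proof
  interpret target_context_category K by (fact assms(1))
  assume "\<exists>r q. simulator_morphism K P s \<T> (trivial_simulator K) r q"
  then obtain r q where mor: "simulator_morphism K P s \<T> (trivial_simulator K) r q"
    by blast
  obtain s\<^sub>T s\<^sub>C where s: "simulator_via K P s s\<^sub>T s\<^sub>C"
    and compr: "\<And>r. lax_reduction_to_trivial K P s r \<Longrightarrow>
      \<exists>t g. t \<in> hom \<I> \<T> \<and> functional K t \<and> g \<in> hom \<I> \<T> \<and> functional K g \<and>
        s\<^sub>T \<cdot> r \<cdot> t = s\<^sub>T \<cdot> r \<cdot> g \<and> \<not> (\<exists>v \<in> hom \<C> \<C>. g \<otimes> \<i>\<d> \<C> \<succeq> t \<otimes> v)"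
    using assms(4) unfolding compressed_def by blast
  have r: "r \<in> hom \<T> P" "functional K r"
    using mor unfolding simulator_morphism_def by blast+
  have f: "s \<cdot> (r \<otimes> \<i>\<d> \<C>) \<in> hom (\<T> \<odot> \<C>) (\<T> \<odot> \<C>)"
    using s homD[OF r(1)] unfolding simulator_via_def hom_iff by auto
  \<comment> \<open>This makes \<open>r\<close> eligible both for the compression property and for
    the hypothesis that reverses the comparison.\<close>
  have lax: "s \<cdot> (r \<otimes> \<i>\<d> \<C>) \<succeq> \<i>\<d> (\<T> \<odot> \<C>)"
    using mor trivialization_lax_reduction[OF f, of q]
    unfolding simulator_morphism_def trivial_simulator_def simulator_def simulator_via_def
    by blast
  obtain t g where "t \<in> hom \<I> \<T>" "functional K t" "g \<in> hom \<I> \<T>" "functional K g"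
    "s\<^sub>T \<cdot> r \<cdot> t = s\<^sub>T \<cdot> r \<cdot> g" "\<not> (\<exists>v \<in> hom \<C> \<C>. g \<otimes> \<i>\<d> \<C> \<succeq> t \<otimes> v)"
    using compr[of r] r lax by (auto simp: lax_reduction_to_trivial_def)
  then show False
    using compression_obstructs_morphism[OF s mor] assms(3)[OF r lax] by blast
qed

end
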